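(* Let $X$ be a compact Hausdorff space and $C(X)$ the algebra of complex-valued continuous functions on $X$ with the supremum norm. Let $\Phi_n^c(C(X),\mathbb{C})$ be the set of continuous Frobenius $n$-homomorphisms $C(X) \to \mathbb{C}$, with the weak-$*$ topology (the topology of pointwise convergence on $C(X)$). Then the map $\mathcal{E} : \mathrm{Sym}^n(X) \to \Phi_n^c(C(X),\mathbb{C})$, $[x_1,\dots,x_n] \mapsto \big(g \mapsto \sum_{k=1}^n g(x_k)\big)$, is a homeomorphism.
   Context: $\mathrm{Sym}^n(X) = X^n/\Sigma_n$ is the $n$-th symmetric product with the quotient topology. For a commutative unital $\mathbb{C}$-algebra $A$, a $\mathbb{C}$-linear map $f : A \to \mathbb{C}$ and $k \ge 1$, define $\Phi_k(f)(a_1,\dots,a_k) = \sum_{\sigma \in \Sigma_k} \epsilon(\sigma) f_\sigma(a_1,\dots,a_k)$, where $\epsilon(\sigma)$ is the sign, and if $\sigma = \gamma_1\cdots\gamma_q$ is the disjoint cycle decomposition (including cycles of length one) then $f_\sigma = \prod_j f_{\gamma_j}$ with $f_\gamma(a_1,\dots,a_k) = f(a_{r_1}\cdots a_{r_j})$ for $\gamma = (r_1\,\dots\,r_j)$. A $\mathbb{C}$-linear map $f$ is a Frobenius $n$-homomorphism if $\Phi_{n+1}(f)$ vanishes identically and $f(1) = n$. *)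

theory Defs
  imports
    "HOL-Analysis.Analysis"
    "HOL-Algebra.Module"
    "HOL-Combinatorics.Orbits"
begin

section \<open>Quotient topology and symmetric products\<close>

definition quotient_topology :: "'a topology \<Rightarrow> ('a \<times> 'a) set \<Rightarrow> 'a set topology" where
  "quotient_topology X r = topology (\<lambda>U. U \<subseteq> topspace X // r \<and> openin X (\<Union>U))"

lemma openin_quotient_topology:
  assumes "equiv (topspace X) r"
  shows "openin (quotient_topology X r) U \<longleftrightarrow> U \<subseteq> topspace X // r \<and> openin X (\<Union>U)"
proof -
  have "istopology (\<lambda>U. U \<subseteq> topspace X // r \<and> openin X (\<Union>U))"
    unfolding istopology_def
  proof (intro conjI allI impI)
    fix S T assume S: "S \<subseteq> topspace X // r \<and> openin X (\<Union>S)"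
      and T: "T \<subseteq> topspace X // r \<and> openin X (\<Union>T)"
    have "\<Union>(S \<inter> T) = \<Union>S \<inter> \<Union>T"
      using S T quotient_disj[OF assms] by blast
    then show "openin X (\<Union>(S \<inter> T))" using S T by (simp add: openin_Int)
  next
    fix \<K> assume K: "\<forall>K\<in>\<K>. K \<subseteq> topspace X // r \<and> openin X (\<Union>K)"
    have "\<Union>(\<Union>\<K>) = \<Union>(Union ` \<K>)" by blast
    then show "openin X (\<Union>(\<Union>\<K>))"
      using K by (metis (no_types, lifting) imageE openin_Union)
  qed blast+
  then show ?thesis
    by (simp add: quotient_topology_def topology_inverse')
qed

lemma topspace_quotient_topology:
  assumes "equiv (topspace X) r"
  shows "topspace (quotient_topology X r) = topspace X // r"
proof -
  have "openin (quotient_topology X r) (topspace X // r)"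
    by (simp add: openin_quotient_topology[OF assms] Union_quotient[OF assms])
  then show ?thesis
    using openin_quotient_topology[OF assms] by (metis openin_subset openin_topspace subset_antisym)
qed

lemma quotient_map_quotient_topology:
  assumes "equiv (topspace X) r"
  shows "quotient_map X (quotient_topology X r) (\<lambda>x. r `` {x})"
proof -
  have "{x \<in> topspace X. r `` {x} \<in> U} = \<Union>U" (is "?L = _") if U: "U \<subseteq> topspace X // r" for U
  proof (intro subset_antisym subsetI)
    fix x assume "x \<in> \<Union>U"
    then obtain c where c: "c \<in> U" "x \<in> c" by blast
    then obtain y where y: "c = r `` {y}" "y \<in> topspace X" using U by (blast elim: quotientE)
    then have "r `` {x} = c"
      using equiv_class_eq[OF assms] c by blast
    moreover have "x \<in> topspace X" using c y U in_quotient_imp_subset[OF assms] by blast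
    ultimately show "x \<in> ?L" using c by simp
  qed (use equiv_class_self[OF assms] in blast)
  then show ?thesis
    unfolding quotient_map_def
    by (auto simp: topspace_quotient_topology[OF assms] openin_quotient_topology[OF assms] quotient_def)
qed

definition power_topology :: "'a topology \<Rightarrow> nat \<Rightarrow> (nat \<Rightarrow> 'a) topology" where
  "power_topology X n = product_topology (\<lambda>_. X) {1..n}"

definition perm_rel :: "'a topology \<Rightarrow> nat \<Rightarrow> ((nat \<Rightarrow> 'a) \<times> (nat \<Rightarrow> 'a)) set" where
  "perm_rel X n = {(x, y). x \<in> topspace (power_topology X n) \<and> y \<in> topspace (power_topology X n) \<and>
     (\<exists>\<sigma>. \<sigma> permutes {1..n} \<and> y = x \<circ> \<sigma>)}"

definition Sym_prod :: "'a topology \<Rightarrow> nat \<Rightarrow> (nat \<Rightarrow> 'a) set topology" where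
  "Sym_prod X n = quotient_topology (power_topology X n) (perm_rel X n)"

lemma equiv_perm_rel: "equiv (topspace (power_topology X n)) (perm_rel X n)"
proof (rule equivI)
  show "perm_rel X n \<subseteq> topspace (power_topology X n) \<times> topspace (power_topology X n)"
    by (auto simp: perm_rel_def)
  have "\<exists>\<sigma>. \<sigma> permutes {1..n} \<and> x = x \<circ> \<sigma>" for x :: "nat \<Rightarrow> 'a"
    by (rule exI[of _ id]) (simp add: permutes_id)
  then show "refl_on (topspace (power_topology X n)) (perm_rel X n)"
    unfolding refl_on_def perm_rel_def by blast
  show "sym (perm_rel X n)"
  proof (rule symI)
    fix x y assume xy: "(x, y) \<in> perm_rel X n"
    then obtain s where s: "s permutes {1..n}" "y = x \<circ> s"
      unfolding perm_rel_def by blast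
    have "x = y \<circ> inv_into UNIV s" using s by (simp add: comp_assoc permutes_inv_o)
    then show "(y, x) \<in> perm_rel X n"
      using xy permutes_inv[OF s(1)] unfolding perm_rel_def mem_Collect_eq case_prod_conv by iprover
  qed
  show "trans (perm_rel X n)"
  proof (rule transI)
    fix x y z assume xy: "(x, y) \<in> perm_rel X n" and yz: "(y, z) \<in> perm_rel X n"
    obtain s where s: "s permutes {1..n}" "y = x \<circ> s"
      using xy unfolding perm_rel_def by blast
    obtain t where t: "t permutes {1..n}" "z = y \<circ> t"
      using yz unfolding perm_rel_def by blast
    have "z = x \<circ> (s \<circ> t)" by (simp add: s(2) t(2) comp_assoc)
    then show "(x, z) \<in> perm_rel X n"
      using xy yz permutes_compose[OF t(1) s(1)] unfolding perm_rel_def mem_Collect_eq case_prod_conv by iprover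
  qed
qed


section \<open>Frobenius homomorphisms on a commutative complex algebra\<close>

definition complex_ring :: "complex ring" where
  "complex_ring = \<lparr>carrier = UNIV, mult = (*), one = 1, zero = 0, add = (+)\<rparr>"

lemma cring_complex_ring: "cring complex_ring"
proof (rule cringI)
  show "abelian_group complex_ring"
  proof (rule abelian_groupI)
    fix z assume "z \<in> carrier complex_ring"
    show "\<exists>w \<in> carrier complex_ring. w \<oplus>\<^bsub>complex_ring\<^esub> z = \<zero>\<^bsub>complex_ring\<^esub>"
      by (rule bexI[of _ "- z"]) (simp_all add: complex_ring_def)
  qed (simp_all add: complex_ring_def)
  show "comm_monoid complex_ring"
    by (rule comm_monoidI) (simp_all add: complex_ring_def)
qed (simp_all add: complex_ring_def algebra_simps)

text \<open>
  The disjoint cycles of a permutation \<open>\<sigma>\<close> of \<open>{1..k}\<close>, fixed points included, correspond to its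
  orbits on \<open>{1..k}\<close>.  As \<open>A\<close> is commutative, the product \<open>a\<^sub>r\<^sub>1 \<cdots> a\<^sub>r\<^sub>j\<close> along a cycle only depends
  on the underlying orbit.
\<close>

definition cycle_prod :: "(complex, 'b) module \<Rightarrow> ('b \<Rightarrow> complex) \<Rightarrow> nat \<Rightarrow> (nat \<Rightarrow> nat) \<Rightarrow> (nat \<Rightarrow> 'b) \<Rightarrow> complex"
  where "cycle_prod A f k \<sigma> a = (\<Prod>C \<in> Orbits.orbit \<sigma> ` {1..k}. f (finprod A a C))"

definition Frob_Phi :: "(complex, 'b) module \<Rightarrow> ('b \<Rightarrow> complex) \<Rightarrow> nat \<Rightarrow> (nat \<Rightarrow> 'b) \<Rightarrow> complex" where
  "Frob_Phi A f k a = (\<Sum>\<sigma> | \<sigma> permutes {1..k}. of_int (sign \<sigma>) * cycle_prod A f k \<sigma> a)"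

definition complex_linear_functional :: "(complex, 'b) module \<Rightarrow> ('b \<Rightarrow> complex) \<Rightarrow> bool" where
  "complex_linear_functional A f \<longleftrightarrow>
     (\<forall>a \<in> carrier A. \<forall>b \<in> carrier A. f (a \<oplus>\<^bsub>A\<^esub> b) = f a + f b) \<and>
     (\<forall>c. \<forall>a \<in> carrier A. f (c \<odot>\<^bsub>A\<^esub> a) = c * f a)"

definition Frobenius_hom :: "(complex, 'b) module \<Rightarrow> nat \<Rightarrow> ('b \<Rightarrow> complex) \<Rightarrow> bool" where
  "Frobenius_hom A n f \<longleftrightarrow>
     complex_linear_functional A f \<and>
     (\<forall>a \<in> {1..n + 1} \<rightarrow> carrier A. Frob_Phi A f (n + 1) a = 0) \<and>
     f \<one>\<^bsub>A\<^esub> = of_nat n"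


section \<open>The algebra \<open>C(X)\<close>\<close>

text \<open>
  Functions on \<open>X\<close> are represented by functions that are extensional on \<open>topspace X\<close>, so that
  equality in the carrier is equality on \<open>X\<close>.
\<close>

definition C_alg :: "'a topology \<Rightarrow> (complex, 'a \<Rightarrow> complex) module" where
  "C_alg X = \<lparr> carrier = {g \<in> extensional (topspace X). continuous_map X euclidean g},
     mult = (\<lambda>g h. \<lambda>x \<in> topspace X. g x * h x),
     one = (\<lambda>x \<in> topspace X. 1),
     zero = (\<lambda>x \<in> topspace X. 0),
     add = (\<lambda>g h. \<lambda>x \<in> topspace X. g x + h x),
     smult = (\<lambda>c g. \<lambda>x \<in> topspace X. c * g x) \<rparr>"

lemma continuous_map_restrict_topspace [simp]:
  "continuous_map X Y (\<lambda>x \<in> topspace X. g x) \<longleftrightarrow> continuous_map X Y g"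
  by (rule iffI; erule continuous_map_eq; simp)

lemma continuous_map_complex_mult:
  fixes g h :: "'a \<Rightarrow> complex"
  assumes "continuous_map X euclidean g" "continuous_map X euclidean h"
  shows "continuous_map X euclidean (\<lambda>x. g x * h x)"
proof -
  have 1: "continuous_map X euclidean (\<lambda>x. (g x, h x))"
    using continuous_map_pairedI[OF assms] by simp
  have 2: "continuous_map euclidean euclidean (\<lambda>p :: complex \<times> complex. fst p * snd p)"
    by (simp add: continuous_on_mult continuous_on_fst continuous_on_snd)
  show ?thesis
    using continuous_map_compose[OF 1 2] by (simp add: comp_def)
qed

lemma algebra_C_alg: "algebra complex_ring (C_alg X)"
proof (rule algebraI)
  show "cring complex_ring" by (rule cring_complex_ring)
  show "cring (C_alg X)"
  proof (rule cringI)
    show "abelian_group (C_alg X)"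
    proof (rule abelian_groupI)
      fix g assume g: "g \<in> carrier (C_alg X)"
      show "\<exists>h \<in> carrier (C_alg X). h \<oplus>\<^bsub>C_alg X\<^esub> g = \<zero>\<^bsub>C_alg X\<^esub>"
        by (rule bexI[of _ "\<lambda>x \<in> topspace X. - g x"])
           (use g in \<open>auto simp: C_alg_def intro!: continuous_map_minus\<close>)
    next
      fix g h assume "g \<in> carrier (C_alg X)" "h \<in> carrier (C_alg X)"
      then show "g \<oplus>\<^bsub>C_alg X\<^esub> h \<in> carrier (C_alg X)"
        by (simp add: C_alg_def continuous_map_add)
    next
      show "\<zero>\<^bsub>C_alg X\<^esub> \<in> carrier (C_alg X)"
        by (simp add: C_alg_def)
    qed (simp_all add: C_alg_def fun_eq_iff restrict_def extensional_def add_ac)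
    show "comm_monoid (C_alg X)"
    proof (rule comm_monoidI)
      fix g h assume "g \<in> carrier (C_alg X)" "h \<in> carrier (C_alg X)"
      then show "g \<otimes>\<^bsub>C_alg X\<^esub> h \<in> carrier (C_alg X)"
        by (simp add: C_alg_def continuous_map_complex_mult)
    next
      show "\<one>\<^bsub>C_alg X\<^esub> \<in> carrier (C_alg X)"
        by (simp add: C_alg_def)
    qed (simp_all add: C_alg_def fun_eq_iff restrict_def extensional_def mult_ac)
  qed (simp add: C_alg_def fun_eq_iff restrict_def distrib_right)
next
  fix c g assume "g \<in> carrier (C_alg X)"
  then show "c \<odot>\<^bsub>C_alg X\<^esub> g \<in> carrier (C_alg X)"
    by (simp add: C_alg_def continuous_map_complex_mult)
qed (simp_all add: C_alg_def complex_ring_def fun_eq_iff restrict_def extensional_def algebra_simps)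

text \<open>The metric of \<open>cfunspace X m\<close> is the supremum distance.\<close>

abbreviation C_topology :: "'a topology \<Rightarrow> ('a \<Rightarrow> complex) topology" where
  "C_topology X \<equiv> mtopology_of (cfunspace X euclidean_metric)"

lemma topspace_C_topology:
  assumes "compact_space X"
  shows "topspace (C_topology X) = carrier (C_alg X)"
proof -
  have "bounded (g ` topspace X)" if "continuous_map X euclidean g" for g :: "'a \<Rightarrow> complex"
    using image_compactin[OF _ that] assms by (auto simp: compact_space_def compact_imp_bounded)
  then show ?thesis
    by (auto simp: C_alg_def Met_TC.fspace_def)
qed


section \<open>The evaluation map\<close>

definition Frob_homs :: "'a topology \<Rightarrow> nat \<Rightarrow> (('a \<Rightarrow> complex) \<Rightarrow> complex) set" where
  "Frob_homs X n = {f \<in> extensional (carrier (C_alg X)).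
     continuous_map (C_topology X) euclidean f \<and> Frobenius_hom (C_alg X) n f}"

definition Frob_homs_weak_star :: "'a topology \<Rightarrow> nat \<Rightarrow> (('a \<Rightarrow> complex) \<Rightarrow> complex) topology" where
  "Frob_homs_weak_star X n =
     subtopology (product_topology (\<lambda>_. euclidean) (carrier (C_alg X))) (Frob_homs X n)"

lemma topspace_Frob_homs_weak_star: "topspace (Frob_homs_weak_star X n) = Frob_homs X n"
  by (auto simp: Frob_homs_weak_star_def Frob_homs_def PiE_def)

definition eval_sum :: "'a topology \<Rightarrow> nat \<Rightarrow> (nat \<Rightarrow> 'a) \<Rightarrow> ('a \<Rightarrow> complex) \<Rightarrow> complex" where
  "eval_sum X n x = (\<lambda>g \<in> carrier (C_alg X). \<Sum>k = 1..n. g (x k))"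

definition Sym_eval :: "'a topology \<Rightarrow> nat \<Rightarrow> (nat \<Rightarrow> 'a) set \<Rightarrow> ('a \<Rightarrow> complex) \<Rightarrow> complex" where
  "Sym_eval X n c = the_elem (eval_sum X n ` c)"

lemma Sym_eval_class:
  assumes "x \<in> topspace (power_topology X n)"
  shows "Sym_eval X n (perm_rel X n `` {x}) = eval_sum X n x"
proof -
  have "eval_sum X n y = eval_sum X n x" if xy: "(x, y) \<in> perm_rel X n" for y
  proof -
    obtain s where s: "s permutes {1..n}" "y = x \<circ> s" using xy unfolding perm_rel_def by blast
    have "(\<Sum>k = 1..n. g (y k)) = (\<Sum>k = 1..n. g (x k))" for g :: "'a \<Rightarrow> complex"
      using sum.permute[OF s(1), of "\<lambda>k. g (x k)"] by (simp add: s(2) comp_def)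
    then show ?thesis by (simp add: eval_sum_def)
  qed
  moreover have "x \<in> perm_rel X n `` {x}"
    using equiv_class_self[OF equiv_perm_rel assms] .
  ultimately have "eval_sum X n ` (perm_rel X n `` {x}) = {eval_sum X n x}" by blast
  then show ?thesis by (simp add: Sym_eval_def)
qed

end

(* A Frobenius n-homomorphism f has at most n points in its support: separate n + 1 of them by
   disjoint open sets and choose a_i supported in the i-th one with f(a_i) nonzero; all products
   a_i a_j with i and j distinct vanish, so Phi_{n+1}(f)(a_1, ..., a_{n+1}) is the product of the
   f(a_i), a contradiction.  By continuity, f is a linear combination of the evaluations at the points
   of its support.  The coefficient c at y is f(u) for a function u that is 1 at y and 0 at
   the other points, and Phi_{n+1}(f)(u, ..., u) = c(c - 1)...(c - n); so c is one of 0, ..., n, and the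
   coefficients add up to f(1) = n.  Conversely, for a sum of n evaluations Phi_{n+1} is a sum over
   colourings of n + 1 indices by n colours, each term being killed by the transposition of two indices
   of equal colour.  The evaluation map is thus a continuous bijection from a compact space to a
   Hausdorff space. *)

theory Submission
  imports Defs
begin

section \<open>Orbits of a permutation and colourings constant on them\<close>

text \<open>\<open>orbit \<sigma> x\<close> is generated from \<open>\<sigma> x\<close>, so that x
  itself belongs to it rests on \<open>\<sigma>\<close> being a permutation of finite support. Given
  this, orbits are equivalence classes.\<close>

lemma orbit_eq_iff:
  assumes "permutation \<sigma>"
  shows "Orbits.orbit \<sigma> x = Orbits.orbit \<sigma> y \<longleftrightarrow> y \<in> Orbits.orbit \<sigma> x"
proof
  show "y \<in> orbit \<sigma> x" if "orbit \<sigma> x = orbit \<sigma> y"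
    using that permutation_self_in_orbit[OF assms] by simp
next
  assume y: "y \<in> orbit \<sigma> x"
  then have "x \<in> orbit \<sigma> y"
    using orbit_swap permutation_self_in_orbit[OF assms] by metis
  with y show "orbit \<sigma> x = orbit \<sigma> y"
    by (meson orbit_trans subsetI subset_antisym)
qed

lemma orbit_subset_of_permutes:
  assumes "\<sigma> permutes S" "x \<in> S"
  shows "Orbits.orbit \<sigma> x \<subseteq> S"
proof
  fix y assume "y \<in> orbit \<sigma> x"
  then show "y \<in> S"
    by induct (use assms in \<open>auto simp: permutes_in_image\<close>)
qed

lemma permutes_fibre:
  assumes "finite S" "\<sigma> permutes S" "C \<in> Orbits.orbit \<sigma> ` S"
  shows "{i \<in> S. Orbits.orbit \<sigma> i = C} = C"
proof -
  have p: "permutation \<sigma>" using assms permutation_permutes by blast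
  obtain x where x: "x \<in> S" "C = orbit \<sigma> x" using assms by blast
  show ?thesis
    using x orbit_subset_of_permutes[OF assms(2) x(1)] orbit_eq_iff[OF p, of x] by blast
qed

lemma prod_over_orbits:
  fixes g :: "'a \<Rightarrow> 'b::comm_monoid_mult"
  assumes "finite S" "\<sigma> permutes S"
  shows "(\<Prod>C \<in> Orbits.orbit \<sigma> ` S. \<Prod>i\<in>C. g i) = (\<Prod>i\<in>S. g i)"
  using prod.image_gen[OF assms(1), of g "Orbits.orbit \<sigma>"] permutes_fibre[OF assms]
  by simp

lemma invariant_on_orbit:
  assumes "\<And>i. i \<in> S \<Longrightarrow> c (\<sigma> i) = c i" "\<sigma> permutes S" "x \<in> S" "y \<in> Orbits.orbit \<sigma> x"
  shows "c y = c x"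
  using assms(4)
proof induct
  case (step y)
  then show ?case using assms orbit_subset_of_permutes[OF assms(2,3)] by auto
qed (use assms in auto)

text \<open>Expanding the product of sums chooses one colour for each orbit. Such choices are the
  same as colourings of \<open>S\<close> that are constant on orbits, that is, invariant under
  \<open>\<sigma>\<close>.\<close>

lemma prod_orbits_sum:
  fixes w :: "'c \<Rightarrow> 'a \<Rightarrow> 'b::comm_semiring_1"
  assumes S: "finite S" and K: "finite K" and \<sigma>: "\<sigma> permutes S"
  shows "(\<Prod>C \<in> Orbits.orbit \<sigma> ` S. \<Sum>j\<in>K. \<Prod>i\<in>C. w j i) =
         (\<Sum>c | c \<in> S \<rightarrow>\<^sub>E K \<and> (\<forall>i\<in>S. c (\<sigma> i) = c i). \<Prod>i\<in>S. w (c i) i)"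
proof -
  let ?O = "Orbits.orbit \<sigma> ` S"
  let ?F = "{c \<in> S \<rightarrow>\<^sub>E K. \<forall>i\<in>S. c (\<sigma> i) = c i}"
  \<comment> \<open>\<open>?h\<close> spreads the colour of an orbit over its elements; its inverse
    \<open>?k\<close> reads the colour at a chosen representative, whose choice is immaterial by
    invariance.\<close>
  let ?h = "\<lambda>d. \<lambda>i\<in>S. d (Orbits.orbit \<sigma> i)"
  let ?k = "\<lambda>c. \<lambda>C\<in>?O. c (SOME i. i \<in> C)"
  have p: "permutation \<sigma>" using S \<sigma> permutation_permutes by blast
  have step: "orbit \<sigma> (\<sigma> i) = orbit \<sigma> i" for i
    using permutation_orbit_step[OF p] .
  have \<sigma>S: "\<sigma> i \<in> S" if "i \<in> S" for i using permutes_in_image[OF \<sigma>] that by simp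
  have some: "(SOME j. j \<in> orbit \<sigma> i) \<in> orbit \<sigma> i" for i
    using orbit_nonempty[of \<sigma> i] by (meson ex_in_conv someI_ex)
  have "(\<Prod>C \<in> ?O. \<Sum>j\<in>K. \<Prod>i\<in>C. w j i) = (\<Sum>d\<in>?O \<rightarrow>\<^sub>E K. \<Prod>C\<in>?O. \<Prod>i\<in>C. w (d C) i)"
    using S K by (subst prod_sum_PiE) auto
  also have "\<dots> = (\<Sum>c\<in>?F. \<Prod>i\<in>S. w (c i) i)"
  proof (rule sum.reindex_bij_witness[of _ ?k ?h])
    fix d assume d: "d \<in> ?O \<rightarrow>\<^sub>E K"
    show "?h d \<in> ?F" using d by (auto simp: step \<sigma>S)
    show "?k (?h d) = d"
    proof
      fix C
      show "?k (?h d) C = d C"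
      proof (cases "C \<in> ?O")
        case True
        then obtain i where i: "i \<in> S" "C = orbit \<sigma> i" by blast
        have "orbit \<sigma> (SOME j. j \<in> C) = C" "(SOME j. j \<in> C) \<in> S"
          using some[of i] i orbit_eq_iff[OF p] orbit_subset_of_permutes[OF \<sigma>] by blast+
        then show ?thesis using True by simp
      qed (use d in \<open>auto simp: PiE_def extensional_def\<close>)
    qed
    have "(\<Prod>i\<in>S. w (?h d i) i) = (\<Prod>i\<in>S. w (d (orbit \<sigma> i)) i)" by simp
    also have "\<dots> = (\<Prod>C\<in>?O. \<Prod>i\<in>C. w (d (orbit \<sigma> i)) i)"
      by (rule prod_over_orbits[OF S \<sigma>, symmetric])
    also have "\<dots> = (\<Prod>C\<in>?O. \<Prod>i\<in>C. w (d C) i)"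
      by (intro prod.cong refl) (use orbit_eq_iff[OF p] in \<open>metis imageE\<close>)
    finally show "(\<Prod>i\<in>S. w (?h d i) i) = (\<Prod>C\<in>?O. \<Prod>i\<in>C. w (d C) i)" .
  next
    fix c assume "c \<in> ?F"
    then have cK: "c \<in> S \<rightarrow>\<^sub>E K" and inv: "\<And>i. i \<in> S \<Longrightarrow> c (\<sigma> i) = c i" by auto
    have *: "c (SOME j. j \<in> orbit \<sigma> i) = c i" if "i \<in> S" for i
      by (rule invariant_on_orbit[OF _ \<sigma> that some[of i]]) (rule inv)
    show "?h (?k c) = c"
      using cK * by (auto simp: fun_eq_iff PiE_def extensional_def)
    show "?k c \<in> ?O \<rightarrow>\<^sub>E K"
      using cK * by (auto simp: PiE_def Pi_def)
  qed
  finally show ?thesis by simp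
qed

section \<open>Alternating sums over a symmetric group\<close>

text \<open>Two indices of equal colour exist by the pigeonhole principle, and composing with their
  transposition is a sign-reversing involution on the permutations preserving the colouring.\<close>

lemma sum_sign_colour_preserving:
  assumes S: "finite S" and K: "finite K" "card K < card S" and c: "c \<in> S \<rightarrow> K"
  shows "(\<Sum>\<sigma> | \<sigma> permutes S \<and> (\<forall>i\<in>S. c (\<sigma> i) = c i). sign \<sigma>) = 0"
proof -
  let ?P = "{\<sigma>. \<sigma> permutes S \<and> (\<forall>i\<in>S. c (\<sigma> i) = c i)}"
  have "\<not> inj_on c S"
    using card_inj_on_le[of c S K] c K by auto
  then obtain i j where ij: "i \<in> S" "j \<in> S" "i \<noteq> j" "c i = c j"
    unfolding inj_on_def by blast
  let ?t = "Transposition.transpose i j"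
  have t: "?t permutes S" using ij by (simp add: permutes_swap_id)
  have ct: "c (?t x) = c x" for x using ij by (simp add: Transposition.transpose_def)
  have mem: "?t \<circ> \<sigma> \<in> ?P" if "\<sigma> \<in> ?P" for \<sigma>
    using that permutes_compose[OF _ t] ct by auto
  have sgn: "sign (?t \<circ> \<sigma>) = - sign \<sigma>" if "\<sigma> \<in> ?P" for \<sigma>
  proof -
    have "permutation \<sigma>" using S that permutation_permutes by blast
    then show ?thesis using ij by (simp add: sign_compose permutation_swap_id sign_swap_id)
  qed
  have "(\<Sum>\<sigma>\<in>?P. sign \<sigma>) = (\<Sum>\<sigma>\<in>?P. - sign \<sigma>)"
    by (rule sum.reindex_bij_witness[of _ "\<lambda>\<sigma>. ?t \<circ> \<sigma>" "\<lambda>\<sigma>. ?t \<circ> \<sigma>"])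
       (use mem sgn in \<open>auto simp: fun_eq_iff\<close>)
  then show ?thesis by (simp add: sum_negf)
qed

text \<open>After exchanging the two sums, each colouring is weighted by the sum of the signs of the
  permutations preserving it, which is 0. With \<open>w j i\<close> the value of the i-th function
  at the j-th point this treats sums of evaluations; with \<open>w = 1\<close> it yields the roots
  of a polynomial.\<close>

lemma alternating_orbit_sum_eq_0:
  fixes w :: "'c \<Rightarrow> 'a \<Rightarrow> 'b::comm_ring_1"
  assumes S: "finite S" and K: "finite K" "card K < card S"
  shows "(\<Sum>\<sigma> | \<sigma> permutes S. of_int (sign \<sigma>) *
            (\<Prod>C \<in> Orbits.orbit \<sigma> ` S. \<Sum>j\<in>K. \<Prod>i\<in>C. w j i)) = 0"
proof -
  let ?P = "{\<sigma>. \<sigma> permutes S}"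
  let ?W = "\<lambda>c. \<Prod>i\<in>S. w (c i) i"
  let ?Q = "\<lambda>c \<sigma>. \<forall>i\<in>S. c (\<sigma> i) = c i"
  have fin: "finite ?P" "finite (S \<rightarrow>\<^sub>E K)" using S K by (auto intro: finite_permutations finite_PiE)
  have "(\<Sum>\<sigma>\<in>?P. of_int (sign \<sigma>) * (\<Prod>C \<in> Orbits.orbit \<sigma> ` S. \<Sum>j\<in>K. \<Prod>i\<in>C. w j i))
      = (\<Sum>\<sigma>\<in>?P. \<Sum>c\<in>S \<rightarrow>\<^sub>E K. if ?Q c \<sigma> then of_int (sign \<sigma>) * ?W c else 0)"
    using S K fin(2)
    by (intro sum.cong refl) (auto simp: prod_orbits_sum sum_distrib_left sum.inter_filter intro!: sum.cong)
  also have "\<dots> = (\<Sum>c\<in>S \<rightarrow>\<^sub>E K. \<Sum>\<sigma>\<in>?P. if ?Q c \<sigma> then of_int (sign \<sigma>) * ?W c else 0)"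
    by (rule sum.swap)
  also have "\<dots> = (\<Sum>c\<in>S \<rightarrow>\<^sub>E K. of_int (\<Sum>\<sigma> | \<sigma> permutes S \<and> ?Q c \<sigma>. sign \<sigma>) * ?W c)"
    by (simp add: sum.inter_filter[OF fin(1), symmetric] sum_distrib_right)
  also have "\<dots> = 0"
    by (rule sum.neutral) (use sum_sign_colour_preserving[OF S K] in \<open>auto simp: PiE_def\<close>)
  finally show ?thesis .
qed

lemma orbit_id: "Orbits.orbit id x = {x}"
proof -
  have "y = x" if "y \<in> Orbits.orbit id x" for y using that by induct auto
  then show ?thesis using orbit.base[of id x] by auto
qed

text \<open>If there are as many orbits as elements, \<open>orbit \<sigma>\<close> is injective on
  \<open>S\<close>; since \<open>\<sigma> x\<close> and x share an orbit, they coincide. This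
  isolates the leading term of the polynomial below.\<close>

lemma card_orbits_eq_iff:
  assumes "finite S" "\<sigma> permutes S"
  shows "card (Orbits.orbit \<sigma> ` S) = card S \<longleftrightarrow> \<sigma> = id"
proof
  assume "card (Orbits.orbit \<sigma> ` S) = card S"
  then have inj: "inj_on (Orbits.orbit \<sigma>) S" using assms eq_card_imp_inj_on by blast
  have p: "permutation \<sigma>" using assms permutation_permutes by blast
  have "\<sigma> x = x" for x
    using inj_onD[OF inj, of "\<sigma> x" x] permutation_orbit_step[OF p, of x] assms(2)
    by (cases "x \<in> S") (auto simp: permutes_in_image permutes_not_in)
  then show "\<sigma> = id" by auto
qed (simp add: orbit_id card_image)

text \<open>By \<open>alternating_orbit_sum_eq_0\<close> the numbers below \<open>card S\<close> are roots of a monic polynomial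
  of degree \<open>card S\<close>, so they are all of its roots.\<close>

lemma alternating_power_sum_eq_0_imp:
  fixes z :: complex
  assumes S: "finite S" and 0: "(\<Sum>\<sigma> | \<sigma> permutes S. of_int (sign \<sigma>) * z ^ card (Orbits.orbit \<sigma> ` S)) = 0"
  shows "\<exists>k < card S. z = of_nat k"
proof -
  let ?P = "{\<sigma>. \<sigma> permutes S}"
  define p :: "complex poly" where
    "p = (\<Sum>\<sigma>\<in>?P. monom (of_int (sign \<sigma>)) (card (Orbits.orbit \<sigma> ` S)))"
  have fin: "finite ?P" using S by (rule finite_permutations)
  have poly: "poly p x = (\<Sum>\<sigma>\<in>?P. of_int (sign \<sigma>) * x ^ card (Orbits.orbit \<sigma> ` S))" for x
    by (simp add: p_def poly_sum poly_monom)
  \<comment> \<open>Only the identity has \<open>card S\<close> orbits, so it alone contributes in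
    this degree, which makes \<open>p\<close> nonzero.\<close>
  have "coeff p (card S) = (\<Sum>\<sigma>\<in>?P. if \<sigma> = id then 1 else 0)"
    unfolding p_def coeff_sum using S
    by (intro sum.cong refl) (auto simp: card_orbits_eq_iff)
  also have "\<dots> = 1" using fin by (simp add: permutes_id)
  finally have "p \<noteq> 0" by auto
  have "degree p \<le> card S"
    unfolding p_def using S fin
    by (intro degree_sum_le) (auto intro: order.trans[OF degree_monom_le] card_image_le)
  \<comment> \<open>With k colours and all weights 1, every orbit contributes the factor k.\<close>
  have "poly p (of_nat k) = 0" if "k < card S" for k
  proof -
    have "k = card {..<k}" by simp
    then show ?thesis
      using alternating_orbit_sum_eq_0[OF S, of "{..<k}" "\<lambda>_ _. 1 :: complex"] that
      by (simp add: poly)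
  qed
  then have sub: "of_nat ` {..<card S} \<subseteq> {x. poly p x = 0}" by auto
  have "card (of_nat ` {..<card S} :: complex set) = card S"
    by (simp add: card_image inj_on_def)
  moreover have "finite {x. poly p x = 0}" "card {x. poly p x = 0} \<le> degree p"
    using \<open>p \<noteq> 0\<close> by (auto intro: poly_roots_finite card_poly_roots_bound)
  ultimately have "of_nat ` {..<card S} = {x. poly p x = 0}"
    using sub \<open>degree p \<le> card S\<close> by (intro card_subset_eq card_seteq) auto
  moreover have "poly p z = 0" using 0 by (simp add: poly)
  ultimately show ?thesis by auto
qed

section \<open>Products and linear functionals on the algebra of continuous functions\<close>

lemma finprod_C_alg:
  assumes "finite C" "a \<in> C \<rightarrow> carrier (C_alg X)"
  shows "finprod (C_alg X) a C = (\<lambda>x\<in>topspace X. \<Prod>i\<in>C. a i x)"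
proof -
  interpret A: algebra complex_ring "C_alg X" by (rule algebra_C_alg)
  show ?thesis
    using assms
  proof (induction C rule: finite_induct)
    case empty
    show ?case by (simp only: A.finprod_empty) (simp add: C_alg_def)
  next
    case (insert i C)
    then have "finprod (C_alg X) a (insert i C) = a i \<otimes>\<^bsub>C_alg X\<^esub> finprod (C_alg X) a C"
      by (intro A.finprod_insert) auto
    with insert show ?case by (auto simp: C_alg_def fun_eq_iff)
  qed
qed

lemma finprod_C_alg_closed:
  assumes "a \<in> C \<rightarrow> carrier (C_alg X)"
  shows "finprod (C_alg X) a C \<in> carrier (C_alg X)"
proof -
  interpret A: algebra complex_ring "C_alg X" by (rule algebra_C_alg)
  show ?thesis using assms by (rule A.finprod_closed)
qed

lemma restrict_in_carrier_C_alg [simp]: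
  "(\<lambda>x\<in>topspace X. g x) \<in> carrier (C_alg X) \<longleftrightarrow> continuous_map X euclidean g"
  by (simp add: C_alg_def)

lemma continuous_map_carrier_C_alg:
  "g \<in> carrier (C_alg X) \<Longrightarrow> continuous_map X euclidean g"
  by (simp add: C_alg_def)

lemma restrict_carrier_C_alg:
  "g \<in> carrier (C_alg X) \<Longrightarrow> (\<lambda>x\<in>topspace X. g x) = g"
  by (simp add: C_alg_def extensional_restrict)

text \<open>Elements of the carrier are extensional, so functions given by pointwise formulas enter
  as restrictions; linearity is recast in that form here and in the next lemmas.\<close>

lemma functional_add:
  assumes "complex_linear_functional (C_alg X) f"
    and "continuous_map X euclidean g" "continuous_map X euclidean h"
  shows "f (\<lambda>x\<in>topspace X. g x + h x) = f (\<lambda>x\<in>topspace X. g x) + f (\<lambda>x\<in>topspace X. h x)"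
proof -
  have "(\<lambda>x\<in>topspace X. g x + h x) = (\<lambda>x\<in>topspace X. g x) \<oplus>\<^bsub>C_alg X\<^esub> (\<lambda>x\<in>topspace X. h x)"
    by (auto simp: C_alg_def fun_eq_iff)
  then show ?thesis
    using assms by (simp add: complex_linear_functional_def)
qed

lemma functional_scale:
  assumes "complex_linear_functional (C_alg X) f" and "continuous_map X euclidean g"
  shows "f (\<lambda>x\<in>topspace X. c * g x) = c * f (\<lambda>x\<in>topspace X. g x)"
proof -
  have "(\<lambda>x\<in>topspace X. c * g x) = c \<odot>\<^bsub>C_alg X\<^esub> (\<lambda>x\<in>topspace X. g x)"
    by (auto simp: C_alg_def fun_eq_iff)
  then show ?thesis
    using assms by (simp add: complex_linear_functional_def)
qed

lemma functional_zero:
  assumes "complex_linear_functional (C_alg X) f"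
  shows "f (\<lambda>x\<in>topspace X. 0) = 0"
  using functional_scale[OF assms, of "\<lambda>_. 0" 0] by simp

lemma functional_sum:
  assumes f: "complex_linear_functional (C_alg X) f" and "finite I"
    and "\<And>i. i \<in> I \<Longrightarrow> continuous_map X euclidean (g i)"
  shows "f (\<lambda>x\<in>topspace X. \<Sum>i\<in>I. g i x) = (\<Sum>i\<in>I. f (\<lambda>x\<in>topspace X. g i x))"
  using assms(2,3)
proof (induction I rule: finite_induct)
  case empty
  show ?case by (simp only: sum.empty functional_zero[OF f])
next
  case (insert i I)
  then have "continuous_map X euclidean (g i)" "continuous_map X euclidean (\<lambda>x. \<Sum>i\<in>I. g i x)"
    by (auto intro!: continuous_map_sum)
  note add = functional_add[OF f this]
  have "f (\<lambda>x\<in>topspace X. \<Sum>i\<in>I. g i x) = (\<Sum>i\<in>I. f (\<lambda>x\<in>topspace X. g i x))"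
    using insert by blast
  then show ?case
    by (simp only: sum.insert[OF insert.hyps] add)
qed

section \<open>Sums of evaluations, and continuity in the supremum metric\<close>

lemma Frobenius_hom_eval_sum:
  assumes "x \<in> topspace (power_topology X n)"
  shows "Frobenius_hom (C_alg X) n (eval_sum X n x)"
proof -
  interpret A: algebra complex_ring "C_alg X" by (rule algebra_C_alg)
  have x: "x k \<in> topspace X" if "k \<in> {1..n}" for k
    using assms that by (auto simp: power_topology_def)
  have "complex_linear_functional (C_alg X) (eval_sum X n x)"
    unfolding complex_linear_functional_def
  proof (intro conjI ballI allI)
    fix g h assume gh: "g \<in> carrier (C_alg X)" "h \<in> carrier (C_alg X)"
    then have "g \<oplus>\<^bsub>C_alg X\<^esub> h \<in> carrier (C_alg X)" by simp
    with gh show "eval_sum X n x (g \<oplus>\<^bsub>C_alg X\<^esub> h) = eval_sum X n x g + eval_sum X n x h"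
      using x by (simp add: eval_sum_def sum.distrib[symmetric]) (simp add: C_alg_def)
  next
    fix c g assume g: "g \<in> carrier (C_alg X)"
    then have "c \<odot>\<^bsub>C_alg X\<^esub> g \<in> carrier (C_alg X)"
      using A.smult_closed[of c g] by (simp add: complex_ring_def)
    with g show "eval_sum X n x (c \<odot>\<^bsub>C_alg X\<^esub> g) = c * eval_sum X n x g"
      using x by (simp add: eval_sum_def sum_distrib_left) (simp add: C_alg_def)
  qed
  moreover have "Frob_Phi (C_alg X) (eval_sum X n x) (n + 1) a = 0"
    if a: "a \<in> {1..n + 1} \<rightarrow> carrier (C_alg X)" for a
  proof -
    \<comment> \<open>Evaluation at a point is multiplicative, so the factor of an orbit is a sum
      over the n points. Having n colours for n + 1 indices is what makes the alternating sum
      vanish.\<close>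
    have "cycle_prod (C_alg X) (eval_sum X n x) (n + 1) \<sigma> a =
        (\<Prod>C \<in> Orbits.orbit \<sigma> ` {1..n + 1}. \<Sum>j\<in>{1..n}. \<Prod>i\<in>C. a i (x j))"
      if \<sigma>: "\<sigma> permutes {1..n + 1}" for \<sigma>
      unfolding cycle_prod_def
    proof (intro prod.cong refl)
      fix C assume "C \<in> Orbits.orbit \<sigma> ` {1..n + 1}"
      then have C: "C \<subseteq> {1..n + 1}" using orbit_subset_of_permutes[OF \<sigma>] by blast
      then have "a \<in> C \<rightarrow> carrier (C_alg X)" using a by blast
      moreover have "finite C" using C finite_subset by blast
      ultimately show "eval_sum X n x (finprod (C_alg X) a C) = (\<Sum>j\<in>{1..n}. \<Prod>i\<in>C. a i (x j))"
        using finprod_C_alg_closed[of a C X] x by (simp add: eval_sum_def finprod_C_alg)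
    qed
    then show ?thesis
      using alternating_orbit_sum_eq_0[of "{1..n + 1}" "{1..n}" "\<lambda>j i. a i (x j)"]
      by (simp add: Frob_Phi_def)
  qed
  moreover have "eval_sum X n x \<one>\<^bsub>C_alg X\<^esub> = of_nat n"
  proof -
    have "\<one>\<^bsub>C_alg X\<^esub> \<in> carrier (C_alg X)" by simp
    then show ?thesis using x by (simp add: eval_sum_def) (simp add: C_alg_def)
  qed
  ultimately show ?thesis by (simp add: Frobenius_hom_def)
qed

lemma mspace_cfunspace_C_alg:
  assumes "compact_space X"
  shows "mspace (cfunspace X euclidean_metric) = carrier (C_alg X)"
  using topspace_C_topology[OF assms] by simp

lemma continuous_map_C_topology_iff:
  fixes f :: "('a \<Rightarrow> complex) \<Rightarrow> complex"
  assumes "compact_space X"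
  shows "continuous_map (C_topology X) euclidean f \<longleftrightarrow>
    (\<forall>a \<in> carrier (C_alg X). \<forall>e>0. \<exists>d>0. \<forall>b \<in> carrier (C_alg X).
       mdist (cfunspace X euclidean_metric) a b < d \<longrightarrow> dist (f a) (f b) < e)"
  using Metric_space.metric_continuous_map[OF Metric_space_mspace_mdist Met_TC.Metric_space_axioms,
      of "cfunspace X euclidean_metric" f]
  by (simp add: mspace_cfunspace_C_alg[OF assms] mtopology_of_def imp_conjL Ball_def del: mspace_cfunspace)
 
lemma continuous_map_eval_sum:
  assumes X: "compact_space X" and x: "x \<in> topspace (power_topology X n)"
  shows "continuous_map (C_topology X) euclidean (eval_sum X n x)"
  unfolding continuous_map_C_topology_iff[OF X]
proof (intro ballI allI impI)
  fix a and e :: real assume a: "a \<in> carrier (C_alg X)" and "e > 0"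
  have xk: "x k \<in> topspace X" if "k \<in> {1..n}" for k
    using x that by (auto simp: power_topology_def)
  \<comment> \<open>The n coordinates contribute at most \<open>?d\<close> each; the divisor n + 1
    keeps the total strictly below e and also covers n = 0.\<close>
  let ?d = "e / (n + 1)"
  have "dist (eval_sum X n x a) (eval_sum X n x b) < e"
    if b: "b \<in> carrier (C_alg X)" and d: "mdist (cfunspace X euclidean_metric) a b < ?d" for b
  proof -
    have "dist (a (x k)) (b (x k)) \<le> ?d" if "k \<in> {1..n}" for k
      using mdist_cfunspace_imp_mdist_le[of a X euclidean_metric b ?d "x k"] a b d xk[OF that]
      unfolding mspace_cfunspace_C_alg[OF X] by simp
    then have "(\<Sum>k=1..n. dist (a (x k)) (b (x k))) \<le> of_nat n * ?d"
      using sum_bounded_above[of "{1..n}" "\<lambda>k. dist (a (x k)) (b (x k))" ?d] by simp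
    moreover have "dist (eval_sum X n x a) (eval_sum X n x b) \<le> (\<Sum>k=1..n. dist (a (x k)) (b (x k)))"
      using a b by (simp add: eval_sum_def dist_norm sum_subtractf[symmetric] norm_sum)
    moreover have "of_nat n * ?d < e" using \<open>e > 0\<close> by (simp add: field_simps)
    ultimately show ?thesis by linarith
  qed
  moreover have "?d > 0" using \<open>e > 0\<close> by simp
  ultimately show "\<exists>d>0. \<forall>b\<in>carrier (C_alg X). mdist (cfunspace X euclidean_metric) a b < d \<longrightarrow>
      dist (eval_sum X n x a) (eval_sum X n x b) < e" by blast
qed

lemma functional_small:
  fixes f :: "('a \<Rightarrow> complex) \<Rightarrow> complex"
  assumes X: "compact_space X" and cont: "continuous_map (C_topology X) euclidean f"
    and f: "complex_linear_functional (C_alg X) f" and "e > 0"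
  obtains d where "d > 0"
    "\<And>b. b \<in> carrier (C_alg X) \<Longrightarrow> (\<And>x. x \<in> topspace X \<Longrightarrow> norm (b x) \<le> d) \<Longrightarrow> norm (f b) < e"
proof -
  let ?z = "\<lambda>x\<in>topspace X. 0 :: complex"
  have "?z \<in> carrier (C_alg X)" by simp
  then obtain d where d: "d > 0" "\<And>b. b \<in> carrier (C_alg X) \<Longrightarrow>
      mdist (cfunspace X euclidean_metric) ?z b < d \<Longrightarrow> dist (f ?z) (f b) < e"
    using cont \<open>e > 0\<close> unfolding continuous_map_C_topology_iff[OF X] by blast
  \<comment> \<open>The pointwise bound gives only a non-strict bound on the supremum distance, so
    halving \<open>d\<close> restores strictness.\<close>
  have "norm (f b) < e" if b: "b \<in> carrier (C_alg X)" "\<And>x. x \<in> topspace X \<Longrightarrow> norm (b x) \<le> d / 2" for b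
  proof -
    have "mdist (cfunspace X euclidean_metric) ?z b \<le> d / 2"
      by (rule mdist_cfunspace_le) (use d b in auto)
    then show ?thesis using d b functional_zero[OF f] by fastforce
  qed
  then show ?thesis using that[of "d / 2"] d by auto
qed

section \<open>Separation of points by functions and by open sets\<close>

lemma Urysohn_bump:
  assumes "compact_space X" "Hausdorff_space X" "closedin X S" "closedin X T" "disjnt S T"
  shows "\<exists>h. continuous_map X euclideanreal h \<and> (\<forall>x\<in>topspace X. 0 \<le> h x) \<and>
    (\<forall>x\<in>S. h x = 0) \<and> (\<forall>x\<in>T. h x = 1)"
proof -
  have "normal_space X"
    using assms compact_Hausdorff_or_regular_imp_normal_space by blast
  then obtain h where h: "continuous_map X (top_of_set {0..1::real}) h" "h ` S \<subseteq> {0}" "h ` T \<subseteq> {1}"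
    using Urysohn_lemma[of X S T 0 1] assms by auto
  then have "continuous_map X euclideanreal h" "h \<in> topspace X \<rightarrow> {0..1}"
    by (auto simp: continuous_map_in_subtopology)
  moreover have "\<forall>x\<in>S. h x = 0" "\<forall>x\<in>T. h x = 1" using h(2,3) by blast+
  ultimately show ?thesis by (intro exI[of _ h]) auto
qed

lemma continuous_map_of_real [continuous_intros]:
  assumes "continuous_map X euclideanreal h"
  shows "continuous_map X euclidean (\<lambda>x. complex_of_real (h x))"
proof -
  have "continuous_map euclideanreal euclidean complex_of_real"
    by (simp add: continuous_on_of_real continuous_on_id)
  from continuous_map_compose[OF assms this] show ?thesis by (simp add: comp_def)
qed

text \<open>Provides functions dual to the evaluations at finitely many points: finite sets are
  closed, so Urysohn's lemma separates y from the rest of \<open>S\<close>.\<close>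

lemma Urysohn_indicator:
  assumes "compact_space X" "Hausdorff_space X" "finite S" "S \<subseteq> topspace X" "y \<in> topspace X"
  obtains u :: "'a \<Rightarrow> complex" where "continuous_map X euclidean u"
    "\<And>x. x \<in> insert y S \<Longrightarrow> u x = of_bool (x = y)"
proof -
  have "closedin X (S - {y})" "closedin X {y}" "disjnt (S - {y}) {y}"
    using assms by (auto intro!: closedin_Hausdorff_finite simp: disjnt_def)
  from Urysohn_bump[OF assms(1,2) this] obtain h where h: "continuous_map X euclideanreal h"
    "\<forall>x\<in>S - {y}. h x = 0" "\<forall>x\<in>{y}. h x = 1"
    by blast
  show ?thesis
    by (rule that[of "\<lambda>x. complex_of_real (h x)"]) (use h in \<open>auto intro: continuous_map_of_real\<close>)
qed

lemma disjoint_neighbourhoods: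
  assumes "Hausdorff_space X" "finite T" "T \<subseteq> topspace X"
  obtains U where "\<And>x. x \<in> T \<Longrightarrow> openin X (U x) \<and> x \<in> U x"
    "\<And>x y. x \<in> T \<Longrightarrow> y \<in> T \<Longrightarrow> x \<noteq> y \<Longrightarrow> U x \<inter> U y = {}"
proof -
  let ?sep = "\<lambda>x y U V. openin X U \<and> openin X V \<and> x \<in> U \<and> y \<in> V \<and> disjnt U V"
  \<comment> \<open>Pairs encode two points and their two neighbourhoods, so a single application of
    choice suffices.\<close>
  have "\<forall>p. \<exists>q. fst p \<in> T \<and> snd p \<in> T \<and> fst p \<noteq> snd p \<longrightarrow> ?sep (fst p) (snd p) (fst q) (snd q)"
  proof
    fix p
    show "\<exists>q. fst p \<in> T \<and> snd p \<in> T \<and> fst p \<noteq> snd p \<longrightarrow> ?sep (fst p) (snd p) (fst q) (snd q)"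
    proof (cases "fst p \<in> T \<and> snd p \<in> T \<and> fst p \<noteq> snd p")
      case True
      with assms(1,3) obtain U V where "?sep (fst p) (snd p) U V"
        unfolding Hausdorff_space_def by (meson subsetD)
      then show ?thesis by (intro exI[of _ "(U, V)"]) simp
    qed blast
  qed
  from choice[OF this] obtain q where q: "\<forall>p. fst p \<in> T \<and> snd p \<in> T \<and> fst p \<noteq> snd p \<longrightarrow>
      ?sep (fst p) (snd p) (fst (q p)) (snd (q p))" ..
  define U where "U x y = fst (q (x, y))" for x y
  define V where "V x y = snd (q (x, y))" for x y
  have UV: "?sep x y (U x y) (V x y)" if "x \<in> T" "y \<in> T" "x \<noteq> y" for x y
    using q[rule_format, of "(x, y)"] that by (simp add: U_def V_def)
  \<comment> \<open>The choices for (x, y) and (y, x) are unrelated, so \<open>W x\<close> lies in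
    the neighbourhoods of x from both. Then \<open>W x\<close> is within \<open>U x y\<close> and
    \<open>W y\<close> within \<open>V x y\<close>, which are disjoint. \<open>topspace X\<close>
    keeps \<open>W x\<close> open when \<open>T\<close> is a singleton.\<close>
  define W where "W x = topspace X \<inter> (\<Inter>y\<in>T - {x}. U x y \<inter> V y x)" for x
  have "openin X (W x) \<and> x \<in> W x" if "x \<in> T" for x
  proof
    have "W x = \<Inter>(insert (topspace X) ((\<lambda>y. U x y \<inter> V y x) ` (T - {x})))"
      by (simp add: W_def)
    also have "openin X \<dots>"
      using UV that assms(2) by (intro openin_Inter) (auto intro!: openin_Int)
    finally show "openin X (W x)" .
    show "x \<in> W x" using UV that assms(3) by (auto simp: W_def)
  qed
  moreover have "W x \<inter> W y = {}" if "x \<in> T" "y \<in> T" "x \<noteq> y" for x y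
    using UV[of x y] that by (auto simp: W_def disjnt_def)
  ultimately show ?thesis by (rule that)
qed

section \<open>The support of a functional\<close>

text \<open>Analogue of the support of a measure: its points are those without an open neighbourhood
  on which f is null.\<close>

definition functional_support :: "'a topology \<Rightarrow> (('a \<Rightarrow> complex) \<Rightarrow> complex) \<Rightarrow> 'a set" where
  "functional_support X f = {x \<in> topspace X. \<forall>U. openin X U \<and> x \<in> U \<longrightarrow>
     (\<exists>a \<in> carrier (C_alg X). (\<forall>y \<in> topspace X - U. a y = 0) \<and> f a \<noteq> 0)}"

text \<open>If \<open>f a\<close> were nonzero, continuity would give a bound d below which
  functions have values smaller than \<open>norm (f a)\<close>. The compact set where
  \<open>norm (a x) \<ge> d\<close> misses the support, so a partition of unity splits
  \<open>a\<close> into null pieces and a remainder bounded by d, a contradiction.\<close>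

lemma functional_vanishes_off_support:
  assumes X: "compact_space X" "Hausdorff_space X"
    and cont: "continuous_map (C_topology X) euclidean f"
    and f: "complex_linear_functional (C_alg X) f"
    and a: "a \<in> carrier (C_alg X)" "\<And>x. x \<in> functional_support X f \<Longrightarrow> a x = 0"
  shows "f a = 0"
proof (rule ccontr)
  assume "f a \<noteq> 0"
  then obtain d where d: "d > 0" "\<And>b. b \<in> carrier (C_alg X) \<Longrightarrow>
      (\<And>x. x \<in> topspace X \<Longrightarrow> norm (b x) \<le> d) \<Longrightarrow> norm (f b) < norm (f a)"
    using functional_small[OF X(1) cont f, of "norm (f a)"] by auto
  have ca: "continuous_map X euclidean a" using a(1) by (rule continuous_map_carrier_C_alg)
  define K where "K = {x \<in> topspace X. d \<le> norm (a x)}"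
  have "closedin X {x \<in> topspace X. norm (a x) \<in> {d..}}"
    by (rule closedin_continuous_map_preimage[OF continuous_map_norm[OF ca]]) simp
  then have K: "compactin X K"
    using X(1) by (simp add: K_def closedin_compact_space)
  \<comment> \<open>On \<open>K\<close> the function \<open>a\<close> is nonzero, so x has a null
    neighbourhood \<open>U\<close>. A bump vanishing off \<open>U\<close> passes nullity on to every
    function that vanishes where the bump does.\<close>
  have "\<forall>x\<in>K. \<exists>h. continuous_map X euclideanreal h \<and> (\<forall>y \<in> topspace X. 0 \<le> h y) \<and> h x = 1 \<and>
      (\<forall>b \<in> carrier (C_alg X). (\<forall>y \<in> topspace X. h y = 0 \<longrightarrow> b y = 0) \<longrightarrow> f b = 0)"
  proof
    fix x assume x: "x \<in> K"
    have "x \<notin> functional_support X f" "x \<in> topspace X"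
      using a(2) x d(1) by (auto simp: K_def)
    then obtain U where U: "openin X U" "x \<in> U"
      "\<And>b. b \<in> carrier (C_alg X) \<Longrightarrow> (\<forall>y \<in> topspace X - U. b y = 0) \<Longrightarrow> f b = 0"
      unfolding functional_support_def by blast
    have "closedin X (topspace X - U)" "closedin X {x}" "disjnt (topspace X - U) {x}"
      using U X \<open>x \<in> topspace X\<close> by (auto intro: closedin_Hausdorff_finite simp: disjnt_def)
    from Urysohn_bump[OF X this] obtain h where "continuous_map X euclideanreal h"
      "\<forall>y\<in>topspace X. 0 \<le> h y" "\<forall>y\<in>topspace X - U. h y = 0" "\<forall>y\<in>{x}. h y = 1"
      by blast
    then show "\<exists>h. continuous_map X euclideanreal h \<and> (\<forall>y \<in> topspace X. 0 \<le> h y) \<and> h x = 1 \<and>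
        (\<forall>b \<in> carrier (C_alg X). (\<forall>y \<in> topspace X. h y = 0 \<longrightarrow> b y = 0) \<longrightarrow> f b = 0)"
      using U(3) by (intro exI[of _ h]) auto
  qed
  from bchoice[OF this] obtain h where "\<forall>x\<in>K. continuous_map X euclideanreal (h x) \<and> (\<forall>y \<in> topspace X. 0 \<le> h x y) \<and>
      h x x = 1 \<and> (\<forall>b \<in> carrier (C_alg X). (\<forall>y \<in> topspace X. h x y = 0 \<longrightarrow> b y = 0) \<longrightarrow> f b = 0)" ..
  then have h: "\<And>x. x \<in> K \<Longrightarrow> continuous_map X euclideanreal (h x)"
      "\<And>x y. x \<in> K \<Longrightarrow> y \<in> topspace X \<Longrightarrow> 0 \<le> h x y" "\<And>x. x \<in> K \<Longrightarrow> h x x = 1"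
    and null: "\<And>x b. x \<in> K \<Longrightarrow> b \<in> carrier (C_alg X) \<Longrightarrow>
      (\<And>y. y \<in> topspace X \<Longrightarrow> h x y = 0 \<Longrightarrow> b y = 0) \<Longrightarrow> f b = 0"
    by auto
  \<comment> \<open>The threshold 1/2 matches the floor in \<open>M\<close> below: on
    \<open>K\<close> some bump exceeds 1/2, hence so does the sum \<open>s\<close>, and there
    \<open>M = s\<close>; everywhere \<open>M\<close> stays positive and can be divided by.\<close>
  define V where "V x = {y \<in> topspace X. h x y \<in> {1/2<..}}" for x
  have "openin X (V x)" if "x \<in> K" for x
    unfolding V_def by (rule openin_continuous_map_preimage[OF h(1)[OF that]]) simp
  moreover have "K \<subseteq> \<Union>(V ` K)" using h(3) by (auto simp: V_def K_def)
  ultimately obtain \<F> where \<F>: "finite \<F>" "\<F> \<subseteq> V ` K" "K \<subseteq> \<Union>\<F>"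
    using compactinD[OF K, of "V ` K"] by blast
  then obtain F where F: "finite F" "F \<subseteq> K" "K \<subseteq> \<Union>(V ` F)"
    using finite_subset_image[of \<F> V K] by metis
  \<comment> \<open>The functions \<open>p x\<close> cut \<open>a\<close> into pieces annihilated by \<open>f\<close>, up to a remainder \<open>r\<close> bounded by
    \<open>d\<close>: it vanishes on \<open>K\<close>, and off \<open>K\<close> already \<open>a\<close> is that small.\<close>
  define s where "s y = (\<Sum>x\<in>F. h x y)" for y
  define M where "M y = max (1/2) (s y)" for y
  define p where "p x y = complex_of_real (h x y / M y) * a y" for x y
  define r where "r y = a y - (\<Sum>x\<in>F. p x y)" for y
  have M: "M y > 0" for y by (simp add: M_def)
  have "continuous_map X euclideanreal s"
    unfolding s_def using F h(1) by (intro continuous_map_sum) auto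
  then have "continuous_map X euclideanreal M"
    unfolding M_def by (intro continuous_map_real_max) auto
  then have cp: "continuous_map X euclidean (p x)" if "x \<in> F" for x
    unfolding p_def using that F h(1) M ca
    by (intro continuous_map_complex_mult continuous_map_of_real continuous_map_real_divide)
       (auto simp: less_imp_neq[symmetric])
  have csum: "continuous_map X euclidean (\<lambda>y. \<Sum>x\<in>F. p x y)"
    using F cp by (intro continuous_map_sum) auto
  have cr: "continuous_map X euclidean r"
    unfolding r_def using ca csum by (intro continuous_map_diff) auto
  have p0: "f (\<lambda>y\<in>topspace X. p x y) = 0" if "x \<in> F" for x
  proof (rule null)
    show "x \<in> K" using that F by blast
    show "(\<lambda>y\<in>topspace X. p x y) \<in> carrier (C_alg X)" using cp[OF that] by simp
  qed (simp add: p_def)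
  have "f a = f (\<lambda>y\<in>topspace X. r y + (\<Sum>x\<in>F. p x y))"
    by (simp add: r_def restrict_carrier_C_alg[OF a(1)])
  also have "\<dots> = f (\<lambda>y\<in>topspace X. r y)"
    by (simp add: functional_add[OF f cr csum] functional_sum[OF f F(1) cp] p0)
  finally have fa: "f a = f (\<lambda>y\<in>topspace X. r y)" .
  have "norm (r y) \<le> d" if y: "y \<in> topspace X" for y
  proof -
    have "(\<Sum>x\<in>F. p x y) = complex_of_real (s y / M y) * a y"
      by (simp add: p_def s_def sum_divide_distrib sum_distrib_right)
    then have "r y = complex_of_real (1 - s y / M y) * a y"
      by (simp add: r_def algebra_simps)
    then have nr: "norm (r y) = \<bar>1 - s y / M y\<bar> * norm (a y)"
      by (simp only: norm_mult norm_of_real)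
    have s0: "0 \<le> s y" unfolding s_def using F h(2) y by (intro sum_nonneg) auto
    show ?thesis
    proof (cases "y \<in> K")
      case True
      then obtain x where x: "x \<in> F" "y \<in> V x" using F by blast
      have "h x y \<le> s y"
        unfolding s_def using F h(2) y x by (intro member_le_sum) auto
      then have "M y = s y" "s y > 0" using x by (auto simp: M_def V_def)
      then show ?thesis using nr d(1) by simp
    next
      case False
      then have "norm (a y) \<le> d" using y by (simp add: K_def)
      \<comment> \<open>From \<open>0 \<le> s y \<le> M y\<close> the quotient lies between 0 and
        1.\<close>
      moreover have "\<bar>1 - s y / M y\<bar> \<le> 1"
        using s0 M[of y] by (auto simp: abs_le_iff M_def field_simps)
      ultimately show ?thesis
        unfolding nr using mult_mono[of "\<bar>1 - s y / M y\<bar>" 1 "norm (a y)" d] by simp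
    qed
  qed
  then have "norm (f (\<lambda>y\<in>topspace X. r y)) < norm (f a)"
    using cr by (intro d(2)) auto
  with fa show False by simp
qed

text \<open>A permutation moving i has i and \<open>\<sigma> i\<close> in one orbit, so the product
  along that orbit is zero and its term vanishes. The identity alone survives, with sign 1 and
  singleton orbits.\<close>

lemma Frob_Phi_orthogonal:
  assumes f: "complex_linear_functional (C_alg X) f"
    and a: "a \<in> {1..k} \<rightarrow> carrier (C_alg X)"
    and orth: "\<And>i j x. \<lbrakk>i \<in> {1..k}; j \<in> {1..k}; i \<noteq> j; x \<in> topspace X\<rbrakk> \<Longrightarrow> a i x * a j x = 0"
  shows "Frob_Phi (C_alg X) f k a = (\<Prod>i\<in>{1..k}. f (a i))"
proof -
  have "cycle_prod (C_alg X) f k \<sigma> a = 0" if \<sigma>: "\<sigma> permutes {1..k}" "\<sigma> \<noteq> id" for \<sigma>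
  proof -
    obtain i where i: "\<sigma> i \<noteq> i" using \<sigma>(2) by fastforce
    then have iS: "i \<in> {1..k}" using \<sigma>(1) permutes_not_in by metis
    let ?C = "Orbits.orbit \<sigma> i"
    have C: "?C \<subseteq> {1..k}" using orbit_subset_of_permutes[OF \<sigma>(1) iS] .
    then have fin: "finite ?C" using finite_subset by blast
    have "permutation \<sigma>" using \<sigma>(1) permutation_permutes by blast
    then have mem: "i \<in> ?C" "\<sigma> i \<in> ?C" by (auto intro: permutation_self_in_orbit orbit.base)
    have "(\<Prod>j\<in>?C. a j x) = 0" if "x \<in> topspace X" for x
    proof -
      have "a i x = 0 \<or> a (\<sigma> i) x = 0"
        using orth[OF subsetD[OF C mem(1)] subsetD[OF C mem(2)] i[symmetric] that] by simp
      then show ?thesis using mem fin by auto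
    qed
    moreover have "a \<in> ?C \<rightarrow> carrier (C_alg X)" using a C by blast
    ultimately have "finprod (C_alg X) a ?C = (\<lambda>x\<in>topspace X. 0)"
      by (subst finprod_C_alg[OF fin]) (auto simp: fun_eq_iff)
    then have "f (finprod (C_alg X) a ?C) = 0" using functional_zero[OF f] by simp
    then show ?thesis unfolding cycle_prod_def
      using iS by (intro prod_zero) auto
  qed
  then have "Frob_Phi (C_alg X) f k a = (\<Sum>\<sigma> | \<sigma> permutes {1..k}. if \<sigma> = id then cycle_prod (C_alg X) f k id a else 0)"
    unfolding Frob_Phi_def by (intro sum.cong) auto
  also have "\<dots> = cycle_prod (C_alg X) f k id a"
    by (simp add: finite_permutations permutes_id)
  also have "\<dots> = (\<Prod>i\<in>{1..k}. f (finprod (C_alg X) a {i}))"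
    unfolding cycle_prod_def by (subst prod.reindex) (auto simp: orbit_id inj_on_def)
  also have "\<dots> = (\<Prod>i\<in>{1..k}. f (a i))"
  proof (rule prod.cong[OF refl])
    fix i assume i: "i \<in> {1..k}"
    then have "a i \<in> carrier (C_alg X)" using a by blast
    then show "f (finprod (C_alg X) a {i}) = f (a i)"
      by (simp add: finprod_C_alg restrict_carrier_C_alg)
  qed
  finally show ?thesis .
qed

lemma card_functional_support:
  assumes X: "Hausdorff_space X" and f: "Frobenius_hom (C_alg X) n f"
  shows "finite (functional_support X f) \<and> card (functional_support X f) \<le> n"
proof (rule ccontr)
  assume "\<not> ?thesis"
  \<comment> \<open>An infinite support and a finite one of more than n points both contain n + 1
    points.\<close>
  then obtain T where T: "T \<subseteq> functional_support X f" "finite T" "card T = n + 1"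
    by (metis Suc_eq_plus1 infinite_arbitrarily_large not_less_eq_eq obtain_subset_with_card_n)
  have TX: "T \<subseteq> topspace X" using T(1) by (auto simp: functional_support_def)
  obtain U where U: "\<And>x. x \<in> T \<Longrightarrow> openin X (U x) \<and> x \<in> U x"
    "\<And>x y. x \<in> T \<Longrightarrow> y \<in> T \<Longrightarrow> x \<noteq> y \<Longrightarrow> U x \<inter> U y = {}"
    using disjoint_neighbourhoods[OF X T(2) TX] by blast
  have "\<exists>a \<in> carrier (C_alg X). (\<forall>y \<in> topspace X - U x. a y = 0) \<and> f a \<noteq> 0" if "x \<in> T" for x
    using U(1)[OF that] T(1) that unfolding functional_support_def by blast
  then obtain b where b: "\<And>x. x \<in> T \<Longrightarrow> b x \<in> carrier (C_alg X)"
    "\<And>x y. x \<in> T \<Longrightarrow> y \<in> topspace X - U x \<Longrightarrow> b x y = 0" "\<And>x. x \<in> T \<Longrightarrow> f (b x) \<noteq> 0"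
    by metis
  obtain t where t: "bij_betw t {1..n + 1} T"
    using T finite_same_card_bij[of "{1..n + 1}" T] by auto
  have lin: "complex_linear_functional (C_alg X) f" using f by (simp add: Frobenius_hom_def)
  have tT: "t i \<in> T" if "i \<in> {1..n + 1}" for i using t that by (rule bij_betwE[rule_format])
  have a: "(\<lambda>i. b (t i)) \<in> {1..n + 1} \<rightarrow> carrier (C_alg X)" using b tT by blast
  have "b (t i) x * b (t j) x = 0"
    if "i \<in> {1..n + 1}" "j \<in> {1..n + 1}" "i \<noteq> j" "x \<in> topspace X" for i j x
  proof -
    have "t i \<noteq> t j" using t that by (auto simp: bij_betw_def inj_on_def)
    then have "x \<notin> U (t i) \<or> x \<notin> U (t j)" using U(2) tT that by blast
    then show ?thesis using b(2) tT that by auto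
  qed
  then have "Frob_Phi (C_alg X) f (n + 1) (\<lambda>i. b (t i)) = (\<Prod>i\<in>{1..n + 1}. f (b (t i)))"
    by (intro Frob_Phi_orthogonal[OF lin a])
  also have "\<dots> \<noteq> 0" using b(3) tT by (subst prod_zero_iff) auto
  finally show False using f a by (simp add: Frobenius_hom_def)
qed

section \<open>Integrality of the coefficients, and surjectivity\<close>

text \<open>Here \<open>u\<close> is idempotent only as far as f can see. Every orbit contributes
  \<open>f u\<close>, so \<open>f u\<close> is a root of the polynomial with roots 0, ..., n.
  Nonempty \<open>C\<close> excludes the empty product, which is the unit.\<close>

lemma Frobenius_hom_idempotent_value:
  assumes f: "Frobenius_hom A n f" and u: "u \<in> carrier A"
    and pow: "\<And>C. finite C \<Longrightarrow> C \<noteq> {} \<Longrightarrow> f (finprod A (\<lambda>_::nat. u) C) = f u"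
  shows "\<exists>m \<le> n. f u = of_nat m"
proof -
  let ?S = "{1..n + 1}"
  have "cycle_prod A f (n + 1) \<sigma> (\<lambda>_. u) = f u ^ card (Orbits.orbit \<sigma> ` ?S)"
    if \<sigma>: "\<sigma> permutes ?S" for \<sigma>
  proof -
    have "f (finprod A (\<lambda>_. u) C) = f u" if C: "C \<in> Orbits.orbit \<sigma> ` ?S" for C
    proof (rule pow)
      show "finite C" using C orbit_subset_of_permutes[OF \<sigma>] finite_subset by blast
      show "C \<noteq> {}" using C orbit_nonempty[of \<sigma>] by blast
    qed
    then show ?thesis by (simp add: cycle_prod_def)
  qed
  moreover have "Frob_Phi A f (n + 1) (\<lambda>_. u) = 0" using f u by (simp add: Frobenius_hom_def)
  ultimately have "(\<Sum>\<sigma> | \<sigma> permutes ?S. of_int (sign \<sigma>) * f u ^ card (Orbits.orbit \<sigma> ` ?S)) = 0"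
    by (simp add: Frob_Phi_def)
  from alternating_power_sum_eq_0_imp[OF _ this] show ?thesis by auto
qed

text \<open>Listing each y exactly \<open>m y\<close> times gives the tuple; the disjoint union
  \<open>?T\<close> has n elements and is enumerated by \<open>{1..n}\<close>.\<close>

lemma multiplicities_realised:
  fixes m :: "'a \<Rightarrow> nat"
  assumes "finite S" "(\<Sum>y\<in>S. m y) = n"
  obtains x where "x \<in> {1..n} \<rightarrow>\<^sub>E S"
    "\<And>g :: 'a \<Rightarrow> complex. (\<Sum>k=1..n. g (x k)) = (\<Sum>y\<in>S. of_nat (m y) * g y)"
proof -
  let ?T = "SIGMA y:S. {..<m y}"
  have "card ?T = n" using assms by (simp add: card_SigmaI)
  then obtain h where h: "bij_betw h {1..n} ?T"
    using assms finite_same_card_bij[of "{1..n}" ?T] by auto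
  show ?thesis
  proof
    show "(\<lambda>k\<in>{1..n}. fst (h k)) \<in> {1..n} \<rightarrow>\<^sub>E S"
      using bij_betwE[OF h] by fastforce
    fix g :: "'a \<Rightarrow> complex"
    have "(\<Sum>k=1..n. g (fst (h k))) = (\<Sum>p\<in>?T. g (fst p))"
      by (rule sum.reindex_bij_betw[OF h])
    also have "\<dots> = (\<Sum>y\<in>S. \<Sum>i<m y. g y)"
      using assms by (subst sum.Sigma) (auto simp: case_prod_beta)
    finally show "(\<Sum>k=1..n. g ((\<lambda>k\<in>{1..n}. fst (h k)) k)) = (\<Sum>y\<in>S. of_nat (m y) * g y)"
      by simp
  qed
qed

lemma Frobenius_hom_is_eval_sum:
  assumes X: "compact_space X" "Hausdorff_space X" and f: "f \<in> Frob_homs X n"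
  shows "\<exists>x \<in> topspace (power_topology X n). f = eval_sum X n x"
proof -
  have cont: "continuous_map (C_topology X) euclidean f" and F: "Frobenius_hom (C_alg X) n f"
    and ext: "f \<in> extensional (carrier (C_alg X))" using f by (auto simp: Frob_homs_def)
  then have lin: "complex_linear_functional (C_alg X) f" by (simp add: Frobenius_hom_def)
  define S where "S = functional_support X f"
  have S: "finite S" "S \<subseteq> topspace X"
    using card_functional_support[OF X(2) F] by (auto simp: S_def functional_support_def)
  have "\<exists>u :: 'a \<Rightarrow> complex. continuous_map X euclidean u \<and> (\<forall>x \<in> S. u x = of_bool (x = y))"
    if "y \<in> S" for y
    using Urysohn_indicator[OF X S, of y] that S(2) by (metis insertCI subsetD)
  then obtain u :: "'a \<Rightarrow> 'a \<Rightarrow> complex" where u: "\<And>y. y \<in> S \<Longrightarrow> continuous_map X euclidean (u y)"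
    "\<And>x y. y \<in> S \<Longrightarrow> x \<in> S \<Longrightarrow> u y x = of_bool (x = y)"
    by metis
  define c where "c y = f (\<lambda>x\<in>topspace X. u y x)" for y
  \<comment> \<open>The difference between \<open>a\<close> and its interpolation by the
    \<open>u y\<close> vanishes on the support, so f annihilates it.\<close>
  have rep: "f a = (\<Sum>y\<in>S. a y * c y)" if a: "a \<in> carrier (C_alg X)" for a
  proof -
    have ca: "continuous_map X euclidean a" using a by (rule continuous_map_carrier_C_alg)
    have cu: "continuous_map X euclidean (\<lambda>x. a y * u y x)" if "y \<in> S" for y
      using u(1)[OF that] by (intro continuous_map_complex_mult) auto
    then have cs: "continuous_map X euclidean (\<lambda>x. \<Sum>y\<in>S. a y * u y x)"
      using S by (intro continuous_map_sum) auto
    let ?r = "\<lambda>x. a x - (\<Sum>y\<in>S. a y * u y x)"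
    have cr: "continuous_map X euclidean ?r" using ca cs by (rule continuous_map_diff)
    have "f (\<lambda>x\<in>topspace X. ?r x) = 0"
    proof (rule functional_vanishes_off_support[OF X cont lin])
      show "(\<lambda>x\<in>topspace X. ?r x) \<in> carrier (C_alg X)" using cr by simp
      fix x assume x: "x \<in> functional_support X f"
      then have "x \<in> S" by (simp add: S_def)
      then have "(\<Sum>y\<in>S. a y * u y x) = (\<Sum>y\<in>S. if x = y then a y else 0)"
        using u(2) by (intro sum.cong) auto
      also have "\<dots> = a x" using S \<open>x \<in> S\<close> by simp
      finally show "(\<lambda>x\<in>topspace X. ?r x) x = 0" using \<open>x \<in> S\<close> S by auto
    qed
    moreover have "f a = f (\<lambda>x\<in>topspace X. ?r x + (\<Sum>y\<in>S. a y * u y x))"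
      by (simp add: restrict_carrier_C_alg[OF a])
    moreover have "f (\<lambda>x\<in>topspace X. \<Sum>y\<in>S. a y * u y x) = (\<Sum>y\<in>S. f (\<lambda>x\<in>topspace X. a y * u y x))"
      by (rule functional_sum[OF lin S(1) cu])
    moreover have "\<dots> = (\<Sum>y\<in>S. a y * c y)"
      by (intro sum.cong refl) (simp only: functional_scale[OF lin u(1)] c_def)
    ultimately show ?thesis
      by (simp only: functional_add[OF lin cr cs] add_0)
  qed
  have "\<exists>m. c y = of_nat m" if y: "y \<in> S" for y
  proof -
    let ?u = "\<lambda>x\<in>topspace X. u y x"
    have uc: "?u \<in> carrier (C_alg X)" using u(1)[OF y] by simp
    \<comment> \<open>On \<open>S\<close> the function \<open>u y\<close> has only the values 0 and
      1, so its positive powers agree with it there, and by \<open>rep\<close> f depends only on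
      values on \<open>S\<close>.\<close>
    have "f (finprod (C_alg X) (\<lambda>_::nat. ?u) C) = f ?u" if C: "finite C" "C \<noteq> {}" for C
    proof -
      have "finprod (C_alg X) (\<lambda>_. ?u) C \<in> carrier (C_alg X)"
        using uc by (intro finprod_C_alg_closed) auto
      moreover have "finprod (C_alg X) (\<lambda>_. ?u) C z = ?u z" if "z \<in> S" for z
      proof -
        have "finprod (C_alg X) (\<lambda>_. ?u) C z = u y z ^ card C"
          using finprod_C_alg[OF C(1), of "\<lambda>_. ?u" X] uc that S by auto
        also have "\<dots> = u y z" using u(2)[OF y that] C by (auto simp: card_gt_0_iff)
        finally show ?thesis using that S by auto
      qed
      ultimately show ?thesis using rep uc by simp
    qed
    then show ?thesis
      using Frobenius_hom_idempotent_value[OF F uc] by (auto simp: c_def)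
  qed
  then obtain m where m: "\<And>y. y \<in> S \<Longrightarrow> c y = of_nat (m y)" by metis
  have "of_nat n = f (\<lambda>x\<in>topspace X. 1)" using F by (simp add: Frobenius_hom_def C_alg_def)
  also have "\<dots> = (\<Sum>y\<in>S. (\<lambda>x\<in>topspace X. 1) y * c y)" by (rule rep) simp
  also have "\<dots> = (\<Sum>y\<in>S. of_nat (m y))" using S m by (intro sum.cong) auto
  finally have "(\<Sum>y\<in>S. m y) = n" by (metis of_nat_eq_iff of_nat_sum)
  then obtain x where x: "x \<in> {1..n} \<rightarrow>\<^sub>E S"
    "\<And>g :: 'a \<Rightarrow> complex. (\<Sum>k=1..n. g (x k)) = (\<Sum>y\<in>S. of_nat (m y) * g y)"
    using multiplicities_realised[OF S(1), of m n] by blast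
  have "f = eval_sum X n x"
  proof
    fix a
    show "f a = eval_sum X n x a"
      using ext rep[of a] x(2)[of a] m
      by (cases "a \<in> carrier (C_alg X)") (auto simp: eval_sum_def extensional_def mult.commute)
  qed
  moreover have "x \<in> topspace (power_topology X n)"
    using x(1) S(2) by (auto simp: power_topology_def PiE_iff)
  ultimately show ?thesis by blast
qed

section \<open>Injectivity, continuity and the homeomorphism\<close>

text \<open>A function that is 1 at z and 0 at the other coordinates turns the sum of evaluations
  into the multiplicity of z. Equal sums thus give equal multisets of coordinates, hence a
  permutation.\<close>

lemma eval_sum_eq_imp_perm_rel:
  assumes X: "compact_space X" "Hausdorff_space X"
    and x: "x \<in> topspace (power_topology X n)" and y: "y \<in> topspace (power_topology X n)"
    and eq: "eval_sum X n x = eval_sum X n y"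
  shows "(x, y) \<in> perm_rel X n"
proof -
  let ?N = "{1..n}"
  let ?T = "x ` ?N \<union> y ` ?N"
  have xe: "x \<in> ?N \<rightarrow>\<^sub>E topspace X" and ye: "y \<in> ?N \<rightarrow>\<^sub>E topspace X"
    using x y by (auto simp: power_topology_def)
  then have T: "finite ?T" "?T \<subseteq> topspace X" by auto
  have "card {k \<in> ?N. y k = z} = card {k \<in> ?N. x k = z}" for z
  proof (cases "z \<in> ?T")
    case True
    then have "z \<in> topspace X" using T by blast
    then obtain u :: "'a \<Rightarrow> complex" where u: "continuous_map X euclidean u"
      "\<And>w. w \<in> insert z ?T \<Longrightarrow> u w = of_bool (w = z)"
      using Urysohn_indicator[OF X T, of z] by metis
    have count: "eval_sum X n v (\<lambda>w\<in>topspace X. u w) = of_nat (card {k \<in> ?N. v k = z})"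
      if v: "v ` ?N \<subseteq> ?T" for v
    proof -
      have "v k \<in> ?T" "v k \<in> topspace X" if "k \<in> ?N" for k using v that T by blast+
      then have "eval_sum X n v (\<lambda>w\<in>topspace X. u w) = (\<Sum>k\<in>?N. of_bool (v k = z))"
        using u by (auto simp: eval_sum_def intro!: sum.cong)
      also have "\<dots> = of_nat (card {k \<in> ?N. v k = z})"
        by (simp add: of_bool_def sum.inter_filter[symmetric])
      finally show ?thesis .
    qed
    have "(of_nat (card {k \<in> ?N. y k = z}) :: complex) = of_nat (card {k \<in> ?N. x k = z})"
      using count[of x] count[of y] eq by simp
    then show ?thesis by simp
  next
    case False
    then have "{k \<in> ?N. y k = z} = {}" "{k \<in> ?N. x k = z} = {}" by auto
    then show ?thesis by (simp only:)
  qed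
  then have "card {k \<in> ?N. z = y k} = card {k \<in> ?N. z = x k}" for z
  proof -
    have "{k \<in> ?N. z = v k} = {k \<in> ?N. v k = z}" for v :: "nat \<Rightarrow> 'a" by auto
    then show ?thesis using \<open>card {k \<in> ?N. y k = z} = card {k \<in> ?N. x k = z}\<close> by (simp only:)
  qed
  then have "image_mset y (mset_set ?N) = image_mset x (mset_set ?N)"
    by (intro multiset_eqI) (simp add: count_image_mset' flip: card_eq_sum)
  then obtain \<sigma> where "\<sigma> permutes ?N" "\<forall>k\<in>?N. y k = x (\<sigma> k)"
    by (rule image_mset_eq_implies_permutes[OF finite_atLeastAtMost])
  then have \<sigma>: "\<sigma> permutes ?N" "\<And>k. k \<in> ?N \<Longrightarrow> y k = x (\<sigma> k)" by auto
  \<comment> \<open>Outside \<open>{1..n}\<close> both tuples are \<open>undefined\<close> and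
    \<open>\<sigma>\<close> fixes the index, so equality holds for all k.\<close>
  have "y k = x (\<sigma> k)" for k
  proof (cases "k \<in> ?N")
    case False
    then show ?thesis
      using permutes_not_in[OF \<sigma>(1) False] xe ye by (simp add: PiE_def extensional_def)
  qed (rule \<sigma>(2))
  then have "y = x \<circ> \<sigma>" by auto
  then show ?thesis using x y \<sigma>(1) unfolding perm_rel_def by blast
qed

lemma continuous_map_eval_sum_weak_star:
  assumes X: "compact_space X"
  shows "continuous_map (power_topology X n) (Frob_homs_weak_star X n) (eval_sum X n)"
  unfolding Frob_homs_weak_star_def continuous_map_in_subtopology
proof
  \<comment> \<open>The weak-* topology is a subspace of a product, so continuity is checked at each
    g separately.\<close>
  have "continuous_map (power_topology X n) euclidean (\<lambda>x. eval_sum X n x g)"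
    if g: "g \<in> carrier (C_alg X)" for g
  proof -
    have "continuous_map (power_topology X n) X (\<lambda>x. x k)" if "k \<in> {1..n}" for k
      unfolding power_topology_def by (rule continuous_map_product_projection[OF that])
    then have "continuous_map (power_topology X n) euclidean (\<lambda>x. \<Sum>k=1..n. g (x k))"
      using continuous_map_compose[OF _ continuous_map_carrier_C_alg[OF g]]
      by (intro continuous_map_sum) (auto simp: comp_def)
    then show ?thesis using g by (simp add: eval_sum_def)
  qed
  then show "continuous_map (power_topology X n) (product_topology (\<lambda>_. euclidean) (carrier (C_alg X)))
      (eval_sum X n)"
    by (auto simp: continuous_map_componentwise eval_sum_def)
  show "eval_sum X n \<in> topspace (power_topology X n) \<rightarrow> Frob_homs X n"
    using Frobenius_hom_eval_sum continuous_map_eval_sum[OF X]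
    by (auto simp: Frob_homs_def) (simp add: eval_sum_def)
qed

theorem theorem3p7:
  fixes X :: "'a topology" and n :: nat
  assumes "compact_space X" and "Hausdorff_space X"
  shows "homeomorphic_map (Sym_prod X n) (Frob_homs_weak_star X n) (Sym_eval X n)"
proof (rule continuous_imp_homeomorphic_map)
  let ?P = "power_topology X n"
  let ?q = "\<lambda>x. perm_rel X n `` {x}"
  have q: "quotient_map ?P (Sym_prod X n) ?q"
    unfolding Sym_prod_def by (rule quotient_map_quotient_topology[OF equiv_perm_rel])
  have top: "topspace (Sym_prod X n) = ?q ` topspace ?P"
    using quotient_imp_surjective_map[OF q] by simp
  have "compact_space ?P"
    unfolding power_topology_def using assms(1) by (simp add: compact_space_product_topology)
  then show "compact_space (Sym_prod X n)"
    using image_compactin[OF _ quotient_imp_continuous_map[OF q]] top by (auto simp: compact_space_def)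
  show "Hausdorff_space (Frob_homs_weak_star X n)"
    unfolding Frob_homs_weak_star_def
    by (intro Hausdorff_space_subtopology) (simp add: Hausdorff_space_product_topology)
  \<comment> \<open>By the universal property of the quotient it suffices that the composite with
    \<open>?q\<close>, which is \<open>eval_sum X n\<close>, is continuous.\<close>
  show "continuous_map (Sym_prod X n) (Frob_homs_weak_star X n) (Sym_eval X n)"
    by (rule continuous_compose_quotient_map[OF q],
        rule continuous_map_eq[OF continuous_map_eval_sum_weak_star[OF assms(1)]])
       (simp add: Sym_eval_class)
  show "Sym_eval X n ` topspace (Sym_prod X n) = topspace (Frob_homs_weak_star X n)"
  proof -
    have "Sym_eval X n ` topspace (Sym_prod X n) = eval_sum X n ` topspace ?P"
      by (simp add: top image_image Sym_eval_class)
    also have "\<dots> = Frob_homs X n"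
    proof
      show "eval_sum X n ` topspace ?P \<subseteq> Frob_homs X n"
        using continuous_map_image_subset_topspace[OF continuous_map_eval_sum_weak_star[OF assms(1)], of n]
        by (simp only: topspace_Frob_homs_weak_star)
      show "Frob_homs X n \<subseteq> eval_sum X n ` topspace ?P"
        using Frobenius_hom_is_eval_sum[OF assms] by blast
    qed
    finally show ?thesis by (simp add: topspace_Frob_homs_weak_star)
  qed
  show "inj_on (Sym_eval X n) (topspace (Sym_prod X n))"
    unfolding top
    by (rule inj_onI)
       (auto simp: Sym_eval_class intro!: equiv_class_eq[OF equiv_perm_rel] eval_sum_eq_imp_perm_rel[OF assms])
qed

end
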